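(* Let $n>1$ be an integer. Then $(\mathbb Z_n,\leq)$ is a lattice if and only if for every factorization $n=n_1n_2$ of $n$ into positive integers with $n_1\geq3$, the ideal $(n_1)$ of $\mathbb Z_n$ generated by $n_1$ has a largest element with respect to $\leq$.
   Context: On $\mathbb Z_n$ define the partial order $\leq$ by: $a\leq b$ iff $a=b$ or $a\equiv ab\pmod n$. *)

theory Defs
  imports "HOL-Number_Theory.Number_Theory" "HOL-Algebra.Algebra"
begin

text \<open>The ring of integers modulo \<open>n\<close> is \<^const>\<open>residue_ring\<close>, with carrier \<open>{0..n - 1}\<close>.\<close>

definition Zn_order :: "int \<Rightarrow> int gorder" where
  "Zn_order n =
     \<lparr>carrier = carrier (residue_ring n), eq = (=),
      le = (\<lambda>a b. a = b \<or> [a = a * b] (mod n))\<rparr>"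

text \<open>The generator is reduced modulo \<open>n\<close> so that it lies in the carrier (it is \<open>0\<close> for \<open>d = n\<close>).\<close>

definition Zn_ideal :: "int \<Rightarrow> int \<Rightarrow> int set" where
  "Zn_ideal n d = Idl\<^bsub>residue_ring n\<^esub> {d mod n}"

end

theory Submission
  imports Defs
begin

text \<open>
  The map \<open>x \<mapsto> 1 - x\<close> reverses the order, because \<open>a \<le> b\<close> for \<open>a \<noteq> b\<close> says \<open>a (1 - b) = 0\<close>;
  hence the order is a lattice as soon as binary meets exist. The common lower bounds of two
  incomparable elements \<open>a\<close>, \<open>b\<close> form the annihilator of \<open>1 - a\<close> and \<open>1 - b\<close>, which is the ideal
  \<open>(n\<^sub>1)\<close> with \<open>n = n\<^sub>1 n\<^sub>2\<close>, \<open>n\<^sub>2 = gcd (n, 1 - a, 1 - b)\<close>; here \<open>n\<^sub>1 \<le> 2\<close> would make \<open>a\<close> and \<open>b\<close>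
  comparable. Conversely, \<open>(n\<^sub>1)\<close> is the set of common lower bounds of \<open>1 + n\<^sub>2\<close> and \<open>1 - n\<^sub>2\<close>, which
  are distinct precisely because \<open>n\<^sub>1 \<ge> 3\<close>.
\<close>

lemma carrier_Zn_order: "carrier (Zn_order n) = {0..<n}"
  by (auto simp: Zn_order_def residue_ring_def)

lemma le_Zn_order_iff: "a \<sqsubseteq>\<^bsub>Zn_order n\<^esub> b \<longleftrightarrow> a = b \<or> n dvd a * (1 - b)"
  by (simp add: Zn_order_def cong_iff_dvd_diff algebra_simps)

lemma eq_if_dvd_diff:
  fixes n :: int
  assumes "a \<in> {0..<n}" "b \<in> {0..<n}" "n dvd a - b"
  shows "a = b"
  using assms by (metis atLeastLessThan_iff mod_eq_dvd_iff mod_pos_pos_trivial)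

lemma dvd_mult_mod_iff: "n dvd x * (y mod n) \<longleftrightarrow> n dvd x * y" for n :: int
  by (simp add: dvd_eq_mod_eq_0 mod_mult_right_eq)

lemma dvd_mult_diff_mod_iff: "n dvd x * (y - z mod n) \<longleftrightarrow> n dvd x * (y - z)" for n :: int
  by (metis dvd_mult_mod_iff mod_diff_right_eq)

lemma partial_order_Zn_order: "partial_order (Zn_order n)"
proof
  fix x y assume *: "x \<sqsubseteq>\<^bsub>Zn_order n\<^esub> y" "y \<sqsubseteq>\<^bsub>Zn_order n\<^esub> x"
    "x \<in> carrier (Zn_order n)" "y \<in> carrier (Zn_order n)"
  have "x = y"
  proof (rule ccontr)
    assume "x \<noteq> y"
    with * have "n dvd x * (1 - y)" "n dvd y * (1 - x)"
      by (auto simp: le_Zn_order_iff)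
    then have "n dvd x * (1 - y) - y * (1 - x)"
      by (rule dvd_diff)
    moreover have "x * (1 - y) - y * (1 - x) = x - y"
      by (simp add: algebra_simps)
    ultimately have "n dvd x - y"
      by simp
    with *(3,4) have "x = y"
      unfolding carrier_Zn_order by (rule eq_if_dvd_diff)
    with \<open>x \<noteq> y\<close> show False ..
  qed
  then show "x .=\<^bsub>Zn_order n\<^esub> y"
    by (simp add: Zn_order_def)
next
  fix x y z assume *: "x \<sqsubseteq>\<^bsub>Zn_order n\<^esub> y" "y \<sqsubseteq>\<^bsub>Zn_order n\<^esub> z"
  show "x \<sqsubseteq>\<^bsub>Zn_order n\<^esub> z"
  proof (cases "x = y \<or> y = z")
    case False
    with * have "n dvd x * (1 - y)" "n dvd y * (1 - z)"
      by (auto simp: le_Zn_order_iff)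
    \<comment> \<open>Splitting \<open>x\<close> as \<open>x * (1 - y) + x * y\<close> makes each
      summand of \<open>x * (1 - z)\<close> a multiple of one of the two hypotheses.\<close>
    then have "n dvd x * (1 - y) * (1 - z) + x * (y * (1 - z))"
      by (metis dvd_add dvd_mult dvd_mult2)
    moreover have "x * (1 - y) * (1 - z) + x * (y * (1 - z)) = x * (1 - z)"
      by (simp add: algebra_simps)
    ultimately show ?thesis
      by (simp add: le_Zn_order_iff)
  next
    case True
    with * show ?thesis by blast
  qed
qed (auto simp: Zn_order_def)

text \<open>As \<open>d\<close> divides \<open>n\<close>, reduction modulo \<open>n\<close> neither
  creates nor destroys divisibility by \<open>d\<close>, so membership in the ideal can be tested on
  the integer representatives.\<close>

lemma Zn_ideal_eq:
  assumes "n > 1" "d dvd n"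
  shows "Zn_ideal n d = {x \<in> {0..<n}. d dvd x}"
proof -
  interpret residues n "residue_ring n"
    using assms by unfold_locales auto
  have "Zn_ideal n d = PIdl\<^bsub>residue_ring n\<^esub> (d mod n)"
    by (simp add: Zn_ideal_def cgenideal_eq_genideal)
  also have "\<dots> = {x * d mod n | x. x \<in> {0..n - 1}}"
    by (simp add: cgenideal_def res_mult_eq res_carrier_eq mod_mult_right_eq)
  also have "\<dots> = {x \<in> {0..<n}. d dvd x}"
  proof (intro subset_antisym subsetI)
    fix y assume "y \<in> {x * d mod n | x. x \<in> {0..n - 1}}"
    then show "y \<in> {x \<in> {0..<n}. d dvd x}"
      using assms by (auto simp: dvd_mod)
  next
    fix y assume y: "y \<in> {x \<in> {0..<n}. d dvd x}"
    then obtain k where k: "y = d * k"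
      by auto
    \<comment> \<open>A negative \<open>d\<close> is allowed, so \<open>k\<close> may lie outside
      the carrier; its residue is the witness.\<close>
    have "y = k mod n * d mod n"
      using y k by (metis (no_types, lifting) atLeastLessThan_iff mem_Collect_eq mod_mult_left_eq
          mod_pos_pos_trivial mult.commute)
    moreover have "k mod n \<in> {0..n - 1}"
      using assms by simp
    ultimately show "y \<in> {x * d mod n | x. x \<in> {0..n - 1}}"
      by blast
  qed
  finally show ?thesis .
qed

lemma greatest_Lower_if_le:
  assumes "partial_order L" "a \<sqsubseteq>\<^bsub>L\<^esub> b" "a \<in> carrier L" "b \<in> carrier L"
  shows "greatest L a (Lower L {a, b})"
proof -
  interpret partial_order L by fact
  show ?thesis
    using assms by (auto simp: greatest_def Lower_def)
qed

text \<open>This computes the common annihilator of \<open>u\<close> and \<open>v\<close> modulo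
  \<open>n\<close>.\<close>

lemma dvd_mult_two_iff:
  fixes n u v x :: int
  assumes "n \<noteq> 0"
  shows "n dvd x * u \<and> n dvd x * v \<longleftrightarrow> n div gcd n (gcd u v) dvd x"
proof -
  define g where "g = gcd n (gcd u v)"
  have g: "g \<noteq> 0" "n = n div g * g"
    using assms by (auto simp: g_def)
  have "n dvd x * u \<and> n dvd x * v \<longleftrightarrow> n dvd gcd (x * u) (x * v)"
    by simp
  also have "\<dots> \<longleftrightarrow> n dvd x * gcd u v"
    by (metis abs_dvd_iff abs_mult dvd_abs_iff gcd_mult_distrib_int abs_gcd_int)
  \<comment> \<open>\<open>n\<close> divides \<open>x * n\<close> in any case, so \<open>n\<close>
    may join the gcd; this turns the factor into a divisor \<open>g\<close> of \<open>n\<close>,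
    which can then be cancelled.\<close>
  also have "\<dots> \<longleftrightarrow> n dvd gcd (x * n) (x * gcd u v)"
    by simp
  also have "\<dots> \<longleftrightarrow> n dvd x * g"
    unfolding g_def by (metis abs_dvd_iff abs_mult dvd_abs_iff gcd_mult_distrib_int abs_gcd_int)
  also have "\<dots> \<longleftrightarrow> n div g dvd x"
    using g by (metis dvd_times_right_cancel_iff)
  finally show ?thesis
    by (simp add: g_def)
qed

text \<open>Incomparability keeps \<open>a\<close> and \<open>b\<close> themselves from being common
  lower bounds, so only the divisibility clause of the order is left, once for \<open>1 - a\<close>
  and once for \<open>1 - b\<close>.\<close>

lemma Lower_Zn_order_incomparable:
  assumes "n > 1" "a \<in> {0..<n}" "b \<in> {0..<n}"
    and "\<not> a \<sqsubseteq>\<^bsub>Zn_order n\<^esub> b" "\<not> b \<sqsubseteq>\<^bsub>Zn_order n\<^esub> a"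
  shows "Lower (Zn_order n) {a, b} = Zn_ideal n (n div gcd n (gcd (1 - a) (1 - b)))"
proof -
  have "n div gcd n (gcd (1 - a) (1 - b)) dvd n"
    by (metis dvd_div_mult_self dvd_triv_left gcd_dvd1)
  with assms show ?thesis
    by (auto simp: Zn_ideal_eq Lower_def carrier_Zn_order le_Zn_order_iff
        simp flip: dvd_mult_two_iff)
qed

text \<open>This excludes the index 2 in the construction of meets. If one of the cofactors of
  \<open>1 - a\<close> and \<open>1 - b\<close> is even, that element is 1 modulo
  \<open>2 * m\<close> and hence lies above everything; if both are odd, \<open>a\<close> and
  \<open>b\<close> are congruent modulo \<open>2 * m\<close>.\<close>

lemma comparable_if_half_dvd:
  fixes m :: int
  assumes "m dvd 1 - a" "m dvd 1 - b" "a \<in> {0..<2 * m}" "b \<in> {0..<2 * m}"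
  shows "a \<sqsubseteq>\<^bsub>Zn_order (2 * m)\<^esub> b \<or> b \<sqsubseteq>\<^bsub>Zn_order (2 * m)\<^esub> a"
proof -
  obtain k l where k: "1 - a = m * k" and l: "1 - b = m * l"
    using assms by (auto elim!: dvdE)
  consider "even k" | "even l" | "even (k - l)"
    by auto
  then show ?thesis
  proof cases
    case 1
    then have "2 * m dvd 1 - a"
      by (simp add: k mult.commute)
    then show ?thesis
      by (simp add: le_Zn_order_iff)
  next
    case 2
    then have "2 * m dvd 1 - b"
      by (simp add: l mult.commute)
    then show ?thesis
      by (simp add: le_Zn_order_iff)
  next
    case 3
    moreover have "b - a = m * (k - l)"
      using k l by (simp add: algebra_simps)
    ultimately have "2 * m dvd b - a"
      by (simp add: mult.commute)
    with assms have "b = a"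
      by (intro eq_if_dvd_diff)
    then show ?thesis
      by (simp add: le_Zn_order_iff)
  qed
qed

lemma ex_meet_Zn_order:
  assumes n: "n > 1" and ab: "a \<in> {0..<n}" "b \<in> {0..<n}"
    and ideals: "\<And>n1 n2 :: int. \<lbrakk>n2 > 0; n = n1 * n2; n1 \<ge> 3\<rbrakk> \<Longrightarrow>
      \<exists>g. greatest (Zn_order n) g (Zn_ideal n n1)"
  shows "\<exists>g. greatest (Zn_order n) g (Lower (Zn_order n) {a, b})"
proof (cases "a \<sqsubseteq>\<^bsub>Zn_order n\<^esub> b \<or> b \<sqsubseteq>\<^bsub>Zn_order n\<^esub> a")
  case True
  then show ?thesis
    using greatest_Lower_if_le[OF partial_order_Zn_order] ab
    by (metis carrier_Zn_order insert_commute)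
next
  case False
  define n2 where "n2 = gcd n (gcd (1 - a) (1 - b))"
  define n1 where "n1 = n div n2"
  have n2: "n2 > 0" "n = n1 * n2"
    using n by (auto simp: n1_def n2_def intro: gcd_pos_int[THEN iffD2])
  have dvds: "n2 dvd 1 - a" "n2 dvd 1 - b"
    unfolding n2_def by (meson dvd_trans gcd_dvd1 gcd_dvd2)+
  have "n1 > 0"
    using n n2 by (metis less_trans zero_less_mult_pos2 zero_less_one)
  \<comment> \<open>If \<open>n1 = 1\<close>, then \<open>n\<close> itself divides
    \<open>1 - a\<close>, which puts \<open>a\<close> above everything.\<close>
  moreover have "n1 \<noteq> 1"
    using False dvds n2 by (auto simp: le_Zn_order_iff)
  moreover have "n1 \<noteq> 2"
    using False dvds n2 ab comparable_if_half_dvd[of n2 a b] by auto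
  ultimately have "n1 \<ge> 3"
    by simp
  then show ?thesis
    using ideals[OF n2] Lower_Zn_order_incomparable[OF n ab] False
    by (simp add: n1_def n2_def)
qed

text \<open>Up to reduction modulo \<open>n\<close>, the product
  \<open>(1 - b) * (1 - (1 - a))\<close> for the left side is the product \<open>a * (1 - b)\<close>
  for the right side.\<close>

lemma le_Zn_order_complement_iff:
  assumes "a \<in> {0..<n}" "b \<in> {0..<n}"
  shows "(1 - b) mod n \<sqsubseteq>\<^bsub>Zn_order n\<^esub> (1 - a) mod n \<longleftrightarrow> a \<sqsubseteq>\<^bsub>Zn_order n\<^esub> b"
proof -
  have "(1 - b) mod n = (1 - a) mod n \<longleftrightarrow> a = b"
    using assms eq_if_dvd_diff[of a n b] by (auto simp: mod_eq_dvd_iff)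
  moreover have "n dvd (1 - b) mod n * (1 - (1 - a) mod n) \<longleftrightarrow> n dvd a * (1 - b)"
    by (simp add: dvd_mult_diff_mod_iff) (simp add: dvd_mult_mod_iff mult.commute[of _ a])
  ultimately show ?thesis
    by (auto simp: le_Zn_order_iff)
qed

text \<open>The complement is an order-reversing involution of the carrier, so the complement of the
  meet of the complements is the join.\<close>

lemma ex_join_Zn_order:
  assumes n: "n > 1" and ab: "a \<in> {0..<n}" "b \<in> {0..<n}"
    and meet: "\<exists>g. greatest (Zn_order n) g (Lower (Zn_order n) {(1 - a) mod n, (1 - b) mod n})"
  shows "\<exists>s. least (Zn_order n) s (Upper (Zn_order n) {a, b})"
proof -
  define c where "c x = (1 - x) mod n" for x
  have c: "c x \<in> {0..<n}" for x
    using n by (simp add: c_def)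
  have cc: "c (c x) = x" if "x \<in> {0..<n}" for x
    using that by (simp add: c_def mod_diff_right_eq)
  have anti: "c y \<sqsubseteq>\<^bsub>Zn_order n\<^esub> c x \<longleftrightarrow> x \<sqsubseteq>\<^bsub>Zn_order n\<^esub> y" if "x \<in> {0..<n}" "y \<in> {0..<n}" for x y
    using le_Zn_order_complement_iff[OF that] by (simp add: c_def)
  obtain g where g: "greatest (Zn_order n) g (Lower (Zn_order n) {c a, c b})"
    using meet by (auto simp: c_def)
  then have g_carrier: "g \<in> {0..<n}" and g_le: "g \<sqsubseteq>\<^bsub>Zn_order n\<^esub> c a" "g \<sqsubseteq>\<^bsub>Zn_order n\<^esub> c b"
    and g_greatest: "\<And>x. x \<in> {0..<n} \<Longrightarrow> x \<sqsubseteq>\<^bsub>Zn_order n\<^esub> c a \<Longrightarrow> x \<sqsubseteq>\<^bsub>Zn_order n\<^esub> c b \<Longrightarrow> x \<sqsubseteq>\<^bsub>Zn_order n\<^esub> g"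
    using c[of a] c[of b] by (auto simp: greatest_def Lower_def carrier_Zn_order)
  have "a \<sqsubseteq>\<^bsub>Zn_order n\<^esub> c g" "b \<sqsubseteq>\<^bsub>Zn_order n\<^esub> c g"
    using anti[OF ab(1) c[of g]] anti[OF ab(2) c[of g]] g_le cc[OF g_carrier] by simp_all
  moreover have "c g \<sqsubseteq>\<^bsub>Zn_order n\<^esub> x"
    if x: "x \<in> {0..<n}" "a \<sqsubseteq>\<^bsub>Zn_order n\<^esub> x" "b \<sqsubseteq>\<^bsub>Zn_order n\<^esub> x" for x
    using g_greatest[OF c[of x]] anti[OF ab(1) x(1)] anti[OF ab(2) x(1)] anti[OF c[of g] x(1)]
      x cc[OF g_carrier] by simp
  ultimately have "least (Zn_order n) (c g) (Upper (Zn_order n) {a, b})"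
    using ab c[of g] by (auto simp: least_def Upper_def carrier_Zn_order)
  then show ?thesis ..
qed

text \<open>Both elements impose the same divisibility condition, \<open>n dvd x * n2\<close>, that
  is \<open>n1 dvd x\<close>. As they are distinct, \<open>x\<close> cannot equal both, so a common
  lower bound must satisfy it.\<close>

lemma Lower_Zn_order_one_plus_minus:
  fixes n1 n2 :: int
  assumes "n1 \<ge> 3" "n2 > 0"
  defines "n \<equiv> n1 * n2"
  shows "Lower (Zn_order n) {(1 + n2) mod n, (1 - n2) mod n} = Zn_ideal n n1"
proof -
  have "n1 * 1 \<le> n1 * n2"
    using assms by (intro mult_left_mono) auto
  then have n: "n > 1"
    unfolding n_def using assms(1) by linarith
  have "\<not> n1 dvd 2"
    using assms by (auto dest: zdvd_imp_le)
  \<comment> \<open>The difference is \<open>2 * n2\<close>; cancelling \<open>n2\<close> would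
    leave \<open>n1 dvd 2\<close>, against \<open>n1 \<ge> 3\<close>.\<close>
  then have "\<not> n dvd (1 + n2) - (1 - n2)"
    using assms by (simp add: n_def flip: mult_2)
  then have "(1 + n2) mod n \<noteq> (1 - n2) mod n"
    by (simp add: mod_eq_dvd_iff)
  moreover have "n dvd x * n2 \<longleftrightarrow> n1 dvd x" for x
    using assms by simp
  ultimately show ?thesis
    using n
    by (auto simp: Zn_ideal_eq Lower_def carrier_Zn_order le_Zn_order_iff dvd_mult_diff_mod_iff n_def)
qed

theorem theorem3p11:
  fixes n :: int
  assumes "n > 1"
  shows "lattice (Zn_order n) \<longleftrightarrow>
    (\<forall>n1 n2 :: int. n1 > 0 \<and> n2 > 0 \<and> n = n1 * n2 \<and> n1 \<ge> 3 \<longrightarrow>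
       (\<exists>g. greatest (Zn_order n) g (Zn_ideal n n1)))"
proof
  assume "lattice (Zn_order n)"
  then interpret lattice "Zn_order n" .
  show "\<forall>n1 n2 :: int. n1 > 0 \<and> n2 > 0 \<and> n = n1 * n2 \<and> n1 \<ge> 3 \<longrightarrow>
       (\<exists>g. greatest (Zn_order n) g (Zn_ideal n n1))"
  proof (intro allI impI)
    fix n1 n2 :: int
    assume *: "n1 > 0 \<and> n2 > 0 \<and> n = n1 * n2 \<and> n1 \<ge> 3"
    have "x mod n \<in> carrier (Zn_order n)" for x
      using assms by (simp add: carrier_Zn_order)
    \<comment> \<open>The meet of these two residues is the largest element of the ideal, which is
      their set of common lower bounds.\<close>
    from inf_of_two_exists[OF this this, of "1 + n2" "1 - n2"]
    show "\<exists>g. greatest (Zn_order n) g (Zn_ideal n n1)"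
      using * Lower_Zn_order_one_plus_minus[of n1 n2] by simp
  qed
next
  assume ideals: "\<forall>n1 n2 :: int. n1 > 0 \<and> n2 > 0 \<and> n = n1 * n2 \<and> n1 \<ge> 3 \<longrightarrow>
       (\<exists>g. greatest (Zn_order n) g (Zn_ideal n n1))"
  have meet: "\<exists>g. greatest (Zn_order n) g (Lower (Zn_order n) {a, b})"
    if "a \<in> {0..<n}" "b \<in> {0..<n}" for a b
    using ex_meet_Zn_order[OF assms that] ideals by simp
  interpret partial_order "Zn_order n"
    by (rule partial_order_Zn_order)
  show "lattice (Zn_order n)"
  proof
    fix a b
    assume "a \<in> carrier (Zn_order n)" "b \<in> carrier (Zn_order n)"
    then have ab: "a \<in> {0..<n}" "b \<in> {0..<n}"
      by (simp_all add: carrier_Zn_order)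
    show "\<exists>g. greatest (Zn_order n) g (Lower (Zn_order n) {a, b})"
      using meet ab .
    show "\<exists>s. least (Zn_order n) s (Upper (Zn_order n) {a, b})"
      using assms ab by (intro ex_join_Zn_order meet) auto
  qed
qed

end
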